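(* Let $m\ge 1$ and $I=\{1,\dots,m\}$. An associative binary operation $a\in\mathcal O_m$ on $I$ is symmetric if and only if it is one of the following operations: $$a(i,j)=j\ \text{ for all } i,j\in I,\qquad\text{or}\qquad a(i,j)=i\ \text{ for all } i,j\in I.$$
   Context: $\mathcal O_m$ denotes the set of all associative binary operations $a\colon I\times I\to I$. $S_m$ is the group of permutations of $I$. An operation $a\in\mathcal O_m$ is called symmetric if it is fixed by the action of every permutation, i.e. $a(j,n)=\pi\big(a(\pi^{-1}(j),\pi^{-1}(n))\big)$ for all $j,n\in I$ and all $\pi\in S_m$. *)

theory Defs
  imports "HOL-Combinatorics.Permutations" "HOL-Library.FuncSet"
begin

definition index_set :: "nat \<Rightarrow> nat set" where
  "index_set m = {1..m}"

text \<open>Operations are extensional functions on \<open>I \<times> I\<close> (undefined elsewhere), so that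
  this is literally the set of associative maps from \<open>I \<times> I\<close> to \<open>I\<close>.\<close>

definition assoc_ops :: "nat \<Rightarrow> (nat \<times> nat \<Rightarrow> nat) set" where
  "assoc_ops m =
     {a \<in> index_set m \<times> index_set m \<rightarrow>\<^sub>E index_set m.
        \<forall>i\<in>index_set m. \<forall>j\<in>index_set m. \<forall>k\<in>index_set m. a (a (i, j), k) = a (i, a (j, k))}"

definition symmetric_op :: "nat \<Rightarrow> (nat \<times> nat \<Rightarrow> nat) \<Rightarrow> bool" where
  "symmetric_op m a \<longleftrightarrow>
     (\<forall>\<pi>. \<pi> permutes index_set m \<longrightarrow>
        (\<forall>j\<in>index_set m. \<forall>n\<in>index_set m. a (j, n) = \<pi> (a (inv \<pi> j, inv \<pi> n))))"

end

theory Submission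
  imports Defs
begin

text \<open>
  Symmetry says that every permutation of the carrier is an automorphism of the semigroup, and
  the carrier is so homogeneous that this leaves no room for a product. The value \<open>a (i, i)\<close> is
  fixed by every permutation fixing \<open>i\<close>. If it were some \<open>k \<noteq> i\<close>, then associativity of
  \<open>i i i\<close> would make \<open>a (i, k)\<close> invariant under exchanging \<open>i\<close> and \<open>k\<close>, hence a third element
  \<open>t\<close>; but exchanging \<open>k\<close> and \<open>t\<close> fixes \<open>i\<close> and moves \<open>a (i, i)\<close>. So every element is idempotent
  (\<open>idempotent\<close>). The same kind of argument applied to \<open>i i j\<close> shows that a product is always one of
  its two factors (\<open>product_in_factors\<close>). Finally, permutations act transitively on ordered pairs of
  distinct elements, so whether the left or the right factor is selected does not depend on the
  pair: the operation is one of the two projections.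

  Conversely, the projections commute with every map, in particular with all permutations.
\<close>

lemma permutes_two_transitive:
  assumes "i \<in> S" "j \<in> S" "i \<noteq> j" "p \<in> S" "q \<in> S" "p \<noteq> q"
  obtains \<pi> where "\<pi> permutes S" "\<pi> i = p" "\<pi> j = q"
proof -
  define b where "b = transpose i p j"
  have b: "b \<in> S" "b \<noteq> p"
    using assms by (auto simp: b_def transpose_def)
  \<comment> \<open>After \<open>i\<close> has been sent to \<open>p\<close>, the image \<open>b\<close> of \<open>j\<close> is corrected to \<open>q\<close>, away from \<open>p\<close>.\<close>
  show thesis
  proof (rule that)
    show "(transpose b q \<circ> transpose i p) permutes S"
      using assms b by (intro permutes_compose permutes_swap_id)
    show "(transpose b q \<circ> transpose i p) i = p"
      using b assms by (simp add: transpose_def)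
    show "(transpose b q \<circ> transpose i p) j = q"
      by (simp add: b_def [symmetric])
  qed
qed

locale symmetric_semigroup =
  fixes S :: "'a set" and a :: "'a \<times> 'a \<Rightarrow> 'a"
  assumes closed: "\<lbrakk>i \<in> S; j \<in> S\<rbrakk> \<Longrightarrow> a (i, j) \<in> S"
    and assoc: "\<lbrakk>i \<in> S; j \<in> S; k \<in> S\<rbrakk> \<Longrightarrow> a (a (i, j), k) = a (i, a (j, k))"
    and equivariant: "\<lbrakk>\<pi> permutes S; i \<in> S; j \<in> S\<rbrakk> \<Longrightarrow> a (\<pi> i, \<pi> j) = \<pi> (a (i, j))"
begin

lemma equivariant_transpose:
  assumes "x \<in> S" "y \<in> S" "i \<in> S" "j \<in> S"
  shows "a (transpose x y i, transpose x y j) = transpose x y (a (i, j))"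
  using assms by (intro equivariant permutes_swap_id)

lemma idempotent:
  assumes i: "i \<in> S"
  shows "a (i, i) = i"
proof (rule ccontr)
  define k where "k = a (i, i)"
  define t where "t = a (i, k)"
  assume "a (i, i) \<noteq> i"
  then have "k \<noteq> i" by (simp add: k_def)
  have S: "k \<in> S" "t \<in> S"
    using i by (auto simp: k_def t_def closed)
  have "a (k, i) = t"
    using assoc [OF i i i] by (simp add: k_def t_def)
  \<comment> \<open>So \<open>t\<close> is both \<open>a (i, k)\<close> and \<open>a (k, i)\<close>, and exchanging \<open>i\<close> and \<open>k\<close> fixes it.\<close>
  then have "transpose i k t = t"
    using equivariant_transpose [of i k i k] i S by (simp add: t_def)
  then have "t \<noteq> i" "t \<noteq> k"
    using \<open>k \<noteq> i\<close> by auto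
  \<comment> \<open>Exchanging \<open>k\<close> and \<open>t\<close> fixes \<open>i\<close>, hence also \<open>a (i, i) = k\<close>.\<close>
  then have "transpose k t k = k"
    using equivariant_transpose [of k t i i] i S \<open>k \<noteq> i\<close> by (simp add: k_def [symmetric])
  then show False
    using \<open>t \<noteq> k\<close> by simp
qed

text \<open>
  For a product \<open>k = a (i, j)\<close>, idempotence and associativity give \<open>a (i, k) = k\<close>. If \<open>k\<close> were a
  third element, exchanging \<open>j\<close> and \<open>k\<close> in \<open>a (i, j) = k\<close> would give \<open>a (i, k) = j\<close> instead.
\<close>

lemma product_in_factors:
  assumes S: "i \<in> S" "j \<in> S"
  shows "a (i, j) = i \<or> a (i, j) = j"
proof (rule ccontr)
  define k where "k = a (i, j)"
  assume "\<not> (a (i, j) = i \<or> a (i, j) = j)"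
  then have k: "k \<noteq> i" "k \<noteq> j" by (auto simp: k_def)
  have "k \<in> S" using S by (simp add: k_def closed)
  have "i \<noteq> j" using k idempotent S by (auto simp: k_def)
  have "a (i, k) = k"
    using assoc [of i i j] S by (simp add: k_def idempotent)
  moreover have "a (i, k) = j"
    using equivariant_transpose [of j k i j] S \<open>k \<in> S\<close> \<open>i \<noteq> j\<close> k
    by (simp add: k_def [symmetric])
  ultimately show False using k by simp
qed

theorem projection:
  "(\<forall>i\<in>S. \<forall>j\<in>S. a (i, j) = j) \<or> (\<forall>i\<in>S. \<forall>j\<in>S. a (i, j) = i)"
proof (rule ccontr)
  assume "\<not> ?thesis"
  then obtain i j p q where S: "i \<in> S" "j \<in> S" "p \<in> S" "q \<in> S"
    and neq: "a (i, j) \<noteq> j" "a (p, q) \<noteq> p"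
    by blast
  have "i \<noteq> j" "p \<noteq> q"
    using neq S idempotent by auto
  then obtain \<pi> where \<pi>: "\<pi> permutes S" "\<pi> i = p" "\<pi> j = q"
    using S permutes_two_transitive by metis
  have "a (i, j) = i"
    using product_in_factors S neq by blast
  then have "a (p, q) = p"
    using equivariant [of \<pi> i j] \<pi> S by simp
  with neq show False by simp
qed

end

text \<open>
  The definition of symmetry evaluates the operation at preimages under the permutation; moving the
  permutation to the other side is what makes it an automorphism.
\<close>

lemma symmetric_op_equivariant:
  assumes "symmetric_op m a" "\<pi> permutes index_set m" "i \<in> index_set m" "j \<in> index_set m"
  shows "a (\<pi> i, \<pi> j) = \<pi> (a (i, j))"
proof -
  have "\<pi> i \<in> index_set m" "\<pi> j \<in> index_set m"
    using assms by (simp_all add: permutes_in_image)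
  then have "a (\<pi> i, \<pi> j) = \<pi> (a (inv \<pi> (\<pi> i), inv \<pi> (\<pi> j)))"
    using assms unfolding symmetric_op_def by blast
  then show ?thesis
    using assms(2) by (simp add: permutes_inverses)
qed

theorem proposition3p5:
  fixes m :: nat and a :: "nat \<times> nat \<Rightarrow> nat"
  assumes "m \<ge> 1"
    and "a \<in> assoc_ops m"
  shows "symmetric_op m a \<longleftrightarrow>
    (\<forall>i\<in>index_set m. \<forall>j\<in>index_set m. a (i, j) = j) \<or>
    (\<forall>i\<in>index_set m. \<forall>j\<in>index_set m. a (i, j) = i)"
    (is "_ \<longleftrightarrow> ?proj")
proof
  assume sym: "symmetric_op m a"
  interpret symmetric_semigroup "index_set m" a
  proof
    show "a (i, j) \<in> index_set m" if "i \<in> index_set m" "j \<in> index_set m" for i j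
      using assms(2) that by (auto simp: assoc_ops_def)
    show "a (a (i, j), k) = a (i, a (j, k))"
      if "i \<in> index_set m" "j \<in> index_set m" "k \<in> index_set m" for i j k
      using assms(2) that by (auto simp: assoc_ops_def)
  qed (rule symmetric_op_equivariant [OF sym])
  show ?proj by (rule projection)
next
  assume proj: ?proj
  show "symmetric_op m a"
    unfolding symmetric_op_def
  proof (intro allI impI ballI)
    fix \<pi> j n
    assume \<pi>: "\<pi> permutes index_set m" and jn: "j \<in> index_set m" "n \<in> index_set m"
    have "inv \<pi> j \<in> index_set m" "inv \<pi> n \<in> index_set m"
      using permutes_in_image [OF permutes_inv [OF \<pi>]] jn by simp_all
    then show "a (j, n) = \<pi> (a (inv \<pi> j, inv \<pi> n))"
      using proj jn permutes_inverses(1) [OF \<pi>] by auto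
  qed
qed

end
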